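(* Let $\phi$ be a linear operator on $\mathbb{R}^n$. Then $\phi$ preserves majorization on $\mathbf{0}^n$ if and only if $$[\phi]=ve^t+\lambda P\quad\text{for some } v\in\mathbb{R}^n,\ \lambda\in\mathbb{R}\text{ and }P\in P(n).$$
   Context: $[\phi]$ is the matrix of $\phi$ in the standard basis, $e=(1,\ldots,1)^t\in\mathbb{R}^n$, and $P(n)$ is the set of $n\times n$ permutation matrices. $\mathbf{0}^n=\{v\in\mathbb{R}^n: e^tv=0\}$ is the set of zero-sum vectors. For $x\in\mathbb{R}^n$, $x^\downarrow$ is the vector of entries of $x$ in non-increasing order. For $a,b\in\mathbb{R}^n$, $a\preceq b$ means $\sum_{j=1}^k a^\downarrow_j\le\sum_{j=1}^k b^\downarrow_j$ for $k=1,\ldots,n-1$ and $\sum_{j=1}^n a^\downarrow_j=\sum_{j=1}^n b^\downarrow_j$. $\phi$ preserves majorization on $\mathbf{0}^n$ if $a\preceq b$ implies $\phi(a)\preceq\phi(b)$ for all $a,b\in\mathbf{0}^n$. *)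

theory Defs
  imports "HOL-Analysis.Analysis"
begin

(* The entries of x in non-increasing order, with multiplicity. This is a list because the
   index type 'n carries no order; the mathematical entry j corresponds to position j - 1. *)
definition decr :: "real ^ 'n \<Rightarrow> real list" where
  "decr x = rev (sorted_list_of_multiset (image_mset (\<lambda>i. x $ i) (mset_set UNIV)))"

lemma mset_decr: "mset (decr x) = image_mset (\<lambda>i. x $ i) (mset_set UNIV)"
  by (simp add: decr_def)

lemma sorted_decr: "sorted_wrt (\<ge>) (decr x)"
  by (simp add: decr_def sorted_wrt_rev)

lemma length_decr: "length (decr (x :: real ^ 'n)) = CARD('n)"
  by (metis mset_decr size_mset size_image_mset size_mset_set)

definition majorized :: "real ^ 'n \<Rightarrow> real ^ 'n \<Rightarrow> bool" (infix "\<preceq>" 50) where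
  "a \<preceq> b \<longleftrightarrow>
     (\<forall>k\<in>{1..CARD('n) - 1}. (\<Sum>j<k. decr a ! j) \<le> (\<Sum>j<k. decr b ! j)) \<and>
     (\<Sum>j<CARD('n). decr a ! j) = (\<Sum>j<CARD('n). decr b ! j)"

(* In real ^ 'n the constant 1 is the all-ones vector e. *)
definition zero_sum :: "(real ^ 'n) set" where
  "zero_sum = {v. 1 \<bullet> v = 0}"

definition preserves_majorization_on :: "(real ^ 'n) set \<Rightarrow> (real ^ 'n \<Rightarrow> real ^ 'n) \<Rightarrow> bool" where
  "preserves_majorization_on S \<phi> \<longleftrightarrow> (\<forall>a\<in>S. \<forall>b\<in>S. a \<preceq> b \<longrightarrow> \<phi> a \<preceq> \<phi> b)"

definition permutation_matrices :: "(real ^ 'n ^ 'n) set" where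
  "permutation_matrices = {\<chi> i j. if j = p i then 1 else 0 | p. p permutes UNIV}"

(* The n x n matrix v w\<^sup>t. *)
definition outer_product :: "real ^ 'n \<Rightarrow> real ^ 'n \<Rightarrow> real ^ 'n ^ 'n" where
  "outer_product v w = (columnvector v :: real ^ 1 ^ 'n) ** (rowvector w :: real ^ 'n ^ 1)"

end

theory Submission
  imports Defs
begin

text \<open>
  Suppose that \<open>\<phi>\<close> preserves majorization on the zero-sum vectors. A vector \<open>x\<close> and its rearrangement
  \<open>x \<circ> \<sigma>\<close> majorize each other, and mutual majorization means equality up to a rearrangement; so
  \<open>\<phi> (x \<circ> \<sigma>)\<close> is a rearrangement of \<open>\<phi> x\<close>. To work on the whole space, precompose \<open>\<phi>\<close> with the
  projection that subtracts the mean, and call the result \<open>\<psi>\<close>. A priori the rearrangement of the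
  values depends on \<open>x\<close>, but there are only finitely many candidates \<open>\<tau>\<close>, and each works
  on a subspace. A vector space over the reals is not a finite union of proper subspaces, so one \<open>\<tau>\<close>
  works for all \<open>x\<close>: \<open>\<psi> (x \<circ> \<sigma>) = \<psi> x \<circ> \<tau>\<close> (\<open>uniform_rearrangement\<close>).

  For the matrix of \<open>\<psi>\<close> this says that permuting the entries of a row in any way gives again a row.
  The orbit of a row under the symmetric group therefore has at most \<open>n\<close> elements. If the row is not
  constant, a value that it takes \<open>k\<close> times gives at least \<open>n choose k\<close> rows, which is too much
  for \<open>2 \<le> k \<le> n - 2\<close>; and a row with distinct entries has an orbit of \<open>n!\<close> elements, which is too
  much for \<open>n \<ge> 3\<close>. What remains is a row that is constant up to one entry; its orbit has
  exactly \<open>n\<close> elements and so exhausts the rows (\<open>rows_closed_under_permutation\<close>). Hence the matrix of \<open>\<psi>\<close> has constant rows, or is, up to an added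
  constant, a multiple of a permutation matrix. Since \<open>\<phi>\<close> and \<open>\<psi>\<close> differ by the
  map that sends \<open>x\<close> to the mean of \<open>x\<close> times \<open>\<phi> e\<close>, the matrix of \<open>\<phi>\<close> has the asserted form.

  Conversely, \<open>v e\<^sup>t\<close> vanishes on zero-sum vectors, permutation matrices do not change the
  decreasing rearrangement, and scaling by any real factor preserves majorization; for the factor
  \<open>- 1\<close> this uses that the total sums agree.
\<close>

section \<open>Decreasing rearrangements and majorization\<close>

lemma decr_unique:
  assumes "sorted_wrt (\<ge>) xs" "mset xs = image_mset (\<lambda>i. x $ i) (mset_set UNIV)"
  shows "decr x = xs"
proof -
  have "sort (rev xs) = rev (decr x)"
    by (rule properties_for_sort) (use assms sorted_decr[of x] in \<open>simp_all add: mset_decr sorted_wrt_rev\<close>)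
  moreover have "sort (rev xs) = rev xs"
    using assms(1) by (intro sorted_sort_id) (simp add: sorted_wrt_rev)
  ultimately show ?thesis by simp
qed

definition permute_entries :: "('n \<Rightarrow> 'n) \<Rightarrow> real ^ 'n \<Rightarrow> real ^ 'n" where
  "permute_entries p x = (\<chi> i. x $ p i)"

lemma permute_entries_nth [simp]: "permute_entries p x $ i = x $ p i"
  by (simp add: permute_entries_def)

lemma linear_permute_entries: "linear (permute_entries p)"
  by (rule linearI) (simp_all add: vec_eq_iff)

lemma decr_permute_entries:
  fixes x :: "real ^ 'n"
  assumes "p permutes UNIV"
  shows "decr (permute_entries p x) = decr x"
proof -
  have "image_mset p (mset_set UNIV) = mset_set UNIV"
    using assms by (simp add: permutes_image permutes_inj image_mset_mset_set)
  then have "image_mset (\<lambda>i. x $ p i) (mset_set UNIV) = image_mset (\<lambda>i. x $ i) (mset_set UNIV)"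
    by (metis (no_types, lifting) multiset.map_comp comp_apply image_mset_cong)
  then show ?thesis by (intro decr_unique) (simp_all add: sorted_decr mset_decr)
qed

lemma decr_eq_imp_permute_entries:
  fixes x y :: "real ^ 'n"
  assumes "decr x = decr y"
  shows "\<exists>p. p permutes UNIV \<and> x = permute_entries p y"
proof -
  have "image_mset (\<lambda>i. x $ i) (mset_set UNIV) = image_mset (\<lambda>i. y $ i) (mset_set UNIV)"
    using assms mset_decr by metis
  from image_mset_eq_implies_permutes[OF _ this] obtain p
    where "p permutes UNIV" "\<forall>i\<in>UNIV. x $ i = y $ p i" by auto
  then show ?thesis by (auto simp: vec_eq_iff)
qed

definition top_sum :: "nat \<Rightarrow> real ^ 'n \<Rightarrow> real" where
  "top_sum k x = (\<Sum>j<k. decr x ! j)"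

lemma top_sum_0 [simp]: "top_sum 0 x = 0"
  by (simp add: top_sum_def)

lemma majorized_iff_top_sum:
  fixes a b :: "real ^ 'n"
  shows "a \<preceq> b \<longleftrightarrow> (\<forall>k\<le>CARD('n). top_sum k a \<le> top_sum k b) \<and> top_sum CARD('n) a = top_sum CARD('n) b"
proof -
  have "k = 0 \<or> k = CARD('n) \<or> k \<in> {1..CARD('n) - 1}" if "k \<le> CARD('n)" for k
    using that by auto
  then show ?thesis
    unfolding majorized_def top_sum_def[symmetric]
    by (smt (verit) atLeastAtMost_iff diff_le_self le_trans order_refl top_sum_0)
qed

lemma majorized_antisym_decr:
  fixes a b :: "real ^ 'n"
  assumes "a \<preceq> b" "b \<preceq> a"
  shows "decr a = decr b"
proof (rule nth_equalityI)
  show "length (decr a) = length (decr b)" by (simp add: length_decr)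
  fix k assume "k < length (decr a)"
  then have k: "Suc k \<le> CARD('n)" by (simp add: length_decr)
  have "top_sum j a = top_sum j b" if "j \<le> CARD('n)" for j
    using assms that by (force simp: majorized_iff_top_sum)
  from this[OF k] this[OF Suc_leD[OF k]] show "decr a ! k = decr b ! k"
    by (simp add: top_sum_def)
qed

lemma majorized_of_decr_eq: "decr a = decr b \<Longrightarrow> a \<preceq> b"
  by (simp add: majorized_def)

lemma top_sum_scaleR:
  fixes a :: "real ^ 'n"
  assumes "c \<ge> 0" "k \<le> CARD('n)"
  shows "top_sum k (c *\<^sub>R a) = c * top_sum k a"
proof -
  have "decr (c *\<^sub>R a) = map ((*) c) (decr a)"
  proof (rule decr_unique)
    show "sorted_wrt (\<ge>) (map ((*) c) (decr a))"
      using sorted_decr[of a] assms(1)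
      by (auto simp: sorted_wrt_map intro: sorted_wrt_mono_rel[rotated] mult_left_mono)
  qed (simp add: mset_decr multiset.map_comp comp_def)
  then show ?thesis
    using assms(2) by (simp add: top_sum_def sum_distrib_left length_decr)
qed

text \<open>Negation reverses the order, so the \<open>k\<close> largest entries of \<open>- a\<close> are the negatives of the
  \<open>k\<close> smallest entries of \<open>a\<close>.\<close>

lemma top_sum_uminus:
  fixes a :: "real ^ 'n"
  assumes "k \<le> CARD('n)"
  shows "top_sum k (- a) = top_sum (CARD('n) - k) a - top_sum CARD('n) a"
proof -
  let ?n = "CARD('n)"
  have decr: "decr (- a) = map uminus (rev (decr a))"
  proof (rule decr_unique)
    show "sorted_wrt (\<ge>) (map uminus (rev (decr a)))"
      using sorted_decr[of a] by (simp add: sorted_wrt_map sorted_wrt_rev)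
  qed (simp add: mset_decr multiset.map_comp comp_def flip: rev_map)
  have "top_sum k (- a) = (\<Sum>j<k. - (decr a ! (?n - Suc j)))"
    unfolding top_sum_def decr
    by (rule sum.cong) (use assms in \<open>auto simp: rev_nth length_decr\<close>)
  also have "\<dots> = - (\<Sum>j\<in>{?n - k..<?n}. decr a ! j)"
    unfolding sum_negf[symmetric]
    by (rule sum.reindex_bij_witness[of _ "\<lambda>j. ?n - Suc j" "\<lambda>j. ?n - Suc j"]) (use assms in auto)
  also have "(\<Sum>j\<in>{?n - k..<?n}. decr a ! j) = top_sum ?n a - top_sum (?n - k) a"
    unfolding top_sum_def lessThan_atLeast0
    by (subst sum_diff_nat_ivl) auto
  finally show ?thesis by simp
qed

lemma majorized_scaleR:
  fixes a b :: "real ^ 'n"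
  assumes "a \<preceq> b"
  shows "c *\<^sub>R a \<preceq> c *\<^sub>R b"
proof (cases "c \<ge> 0")
  case True
  then show ?thesis
    using assms by (simp add: majorized_iff_top_sum top_sum_scaleR mult_left_mono)
next
  case False
  have "- a \<preceq> - b"
    using assms by (simp add: majorized_iff_top_sum top_sum_uminus)
  then have "(- c) *\<^sub>R (- a) \<preceq> (- c) *\<^sub>R (- b)"
    using False by (simp add: majorized_iff_top_sum top_sum_scaleR mult_left_mono_neg
        del: scaleR_minus_left scaleR_minus_right)
  then show ?thesis by simp
qed

section \<open>Arrays whose rows are closed under permutation\<close>

lemma less_binomial:
  fixes n k :: nat
  assumes "2 \<le> k" "k + 2 \<le> n"
  shows "n < n choose k"
  using assms
proof (induction n arbitrary: k)
  case (Suc n)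
  obtain j where k: "k = Suc j" using Suc.prems by (cases k) auto
  show ?case
  proof (cases "k + 2 \<le> n")
    case True
    then have "n < n choose k" using Suc by blast
    moreover have "0 < n choose j" using True k by simp
    ultimately show ?thesis unfolding k binomial_Suc_Suc by linarith
  next
    case False
    then have n: "n = Suc k" using Suc.prems by simp
    \<comment> \<open>Here \<open>n + 1 = k + 2\<close>, so the binomial coefficient equals \<open>(n + 1) choose 2\<close>.\<close>
    have "Suc n choose k = Suc n choose 2"
      using binomial_symmetric[of k "Suc n"] n by simp
    also have "\<dots> = n + (n choose 2)" by (simp add: numeral_2_eq_2)
    also have "n choose 2 = (k choose 1) + (k choose 2)" by (simp add: n numeral_2_eq_2)
    also have "n + ((k choose 1) + (k choose 2)) > Suc n" using Suc.prems by simp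
    finally show ?thesis .
  qed
qed simp

lemma permutation_moving_set:
  fixes B C :: "'n :: finite set"
  assumes "card B = card C"
  shows "\<exists>p. p permutes UNIV \<and> (\<forall>i. p i \<in> C \<longleftrightarrow> i \<in> B)"
proof -
  obtain f where f: "bij_betw f B C" using assms finite_same_card_bij by (metis finite)
  have "card (- B) = card (- C)" using assms by (simp add: Compl_eq_Diff_UNIV card_Diff_subset)
  then obtain g where g: "bij_betw g (- B) (- C)" using finite_same_card_bij by (metis finite)
  let ?p = "\<lambda>i. if i \<in> B then f i else g i"
  have "bij_betw ?p (B \<union> - B) (C \<union> - C)"
    by (rule bij_betw_disjoint_Un) (use f g in auto)
  then have "?p permutes UNIV" by (intro bij_imp_permutes) auto
  moreover have "?p i \<in> C \<longleftrightarrow> i \<in> B" for i using f g by (auto dest: bij_betwE)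
  ultimately show ?thesis by blast
qed

text \<open>This is the orbit count. A value taken \<open>k\<close> times by a row occurs in the rearranged rows exactly
  on the sets of size \<open>k\<close>, all of which arise, so \<open>n choose k \<le> n\<close>. With a repeated value this forces
  \<open>k = n - 1\<close>. Without one, the \<open>n!\<close> rearrangements of the row are distinct, which forces \<open>n = 2\<close>,
  where a row with two different entries has the required form.\<close>

lemma row_constant_up_to_one_entry:
  fixes M :: "'n :: finite \<Rightarrow> 'n \<Rightarrow> 'a"
  assumes closed: "\<And>p k. p permutes UNIV \<Longrightarrow> M k \<circ> p \<in> range M"
    and nonconst: "M k i \<noteq> M k j"
  shows "\<exists>i0 c. (\<forall>i. i \<noteq> i0 \<longrightarrow> M k i = c) \<and> M k i0 \<noteq> c"
proof -
  let ?n = "CARD('n)"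
  have card_range: "card (range M) \<le> ?n" by (rule card_image_le) simp
  have "\<exists>i0 c. \<forall>i. i \<noteq> i0 \<longrightarrow> M k i = c"
  proof (cases "inj (M k)")
    case True
    have "fact ?n = card ((\<lambda>p. M k \<circ> p) ` {p. p permutes UNIV})"
      by (subst card_image) (use True in \<open>auto simp: inj_on_def fun_eq_iff card_permutations\<close>)
    also have "\<dots> \<le> card (range M)" by (rule card_mono) (use closed in auto)
    finally have le: "fact ?n \<le> ?n" using card_range by simp
    have "?n \<le> 2"
    proof (rule ccontr)
      assume "\<not> ?n \<le> 2"
      then obtain m where m: "?n = Suc m" "m \<ge> 2" by (cases ?n) auto
      have "(2 :: nat) \<le> fact m" using fact_ge_self[of m] m(2) by linarith
      then have "Suc m * 2 \<le> fact ?n" unfolding m(1) fact_Suc of_nat_id by (rule mult_le_mono2)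
      then show False using le m by simp
    qed
    moreover have "card {i, j} = 2" using nonconst by (cases "i = j") auto
    ultimately have "{i, j} = UNIV" by (intro card_seteq) auto
    then show ?thesis by (intro exI[of _ j] exI[of _ "M k i"]) (metis UNIV_I insertE singletonD)
  next
    case False
    then obtain a b where ab: "a \<noteq> b" "M k a = M k b" by (auto simp: inj_def)
    define c where "c = M k a"
    define C where "C = {i. M k i = c}"
    have "card {a, b} \<le> card C" by (rule card_mono) (use ab in \<open>auto simp: C_def c_def\<close>)
    then have ge2: "2 \<le> card C" using ab by simp
    have "{B. card B = card C} \<subseteq> (\<lambda>r. {i. r i = c}) ` range M"
    proof
      fix B :: "'n set" assume "B \<in> {B. card B = card C}"
      then have "card B = card C" by simp
      then obtain p where p: "p permutes UNIV" "\<And>i. p i \<in> C \<longleftrightarrow> i \<in> B"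
        using permutation_moving_set by blast
      then have "B = {i. (M k \<circ> p) i = c}" by (auto simp: C_def)
      then show "B \<in> (\<lambda>r. {i. r i = c}) ` range M" using closed[OF p(1)] by blast
    qed
    then have "card {B :: 'n set. card B = card C} \<le> card (range M)"
      by (rule surj_card_le[OF finite_imageI[OF finite]])
    moreover have "card {B :: 'n set. card B = card C} = ?n choose card C"
      using n_subsets[of "UNIV :: 'n set" "card C"] by simp
    ultimately have "\<not> ?n < ?n choose card C" using card_range by simp
    then have "?n \<le> card C + 1" using less_binomial[OF ge2, of ?n] by linarith
    then have le1: "card (- C) \<le> 1" by (simp add: Compl_eq_Diff_UNIV card_Diff_subset)
    have "i \<in> - C \<or> j \<in> - C" using nonconst by (auto simp: C_def)
    then have "card (- C) = 1"
      using le1 by (intro le_antisym) (auto simp: Suc_le_eq card_gt_0_iff)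
    then obtain i0 where "- C = {i0}" by (rule card_1_singletonE)
    then have "\<forall>i. i \<noteq> i0 \<longrightarrow> M k i = c" by (auto simp: C_def)
    then show ?thesis by blast
  qed
  then show ?thesis using nonconst by metis
qed

lemma rows_closed_under_permutation:
  fixes M :: "'n :: finite \<Rightarrow> 'n \<Rightarrow> 'a"
  assumes closed: "\<And>p k. p permutes UNIV \<Longrightarrow> M k \<circ> p \<in> range M"
  shows "(\<forall>k i j. M k i = M k j) \<or> (\<exists>p c d. p permutes UNIV \<and> (\<forall>k j. M k j = (if j = p k then d else c)))"
proof (cases "\<forall>k i j. M k i = M k j")
  case False
  then obtain k i j where "M k i \<noteq> M k j" by blast
  from row_constant_up_to_one_entry[OF closed this] obtain i0 c
    where c: "\<And>i. i \<noteq> i0 \<Longrightarrow> M k i = c" and neq: "M k i0 \<noteq> c" by blast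
  define d where "d = M k i0"
  have "\<exists>l. \<forall>j. M l j = (if j = i then d else c)" for i
  proof -
    have "M k \<circ> Transposition.transpose i i0 \<in> range M" by (rule closed) (simp add: permutes_swap_id)
    moreover have "(M k \<circ> Transposition.transpose i i0) j = (if j = i then d else c)" for j
      using c by (auto simp: d_def Transposition.transpose_def)
    ultimately show ?thesis by (metis imageE)
  qed
  then obtain q where q: "\<And>i j. M (q i) j = (if j = i then d else c)" by metis
  \<comment> \<open>The \<open>n\<close> rearrangements of the row are distinct, so they use up all \<open>n\<close> row indices.\<close>
  have "inj q"
  proof (rule injI)
    fix i j assume "q i = q j"
    then show "i = j" using q[of i i] q[of j i] neq by (auto simp: d_def split: if_splits)
  qed
  then have "bij q" by (simp add: bij_def finite_UNIV_inj_surj)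
  then have "inv q permutes UNIV" "\<And>k. q (inv q k) = k"
    by (auto intro: bij_imp_permutes bij_imp_bij_inv simp: bij_is_surj surj_f_inv_f)
  then show ?thesis using q by metis
qed simp

section \<open>Linear maps that send rearrangements to rearrangements\<close>

text \<open>Proper subspaces are null sets, and finitely many null sets do not cover the space.\<close>

lemma finite_Union_subspaces_UNIV:
  fixes F :: "'a :: euclidean_space set set"
  assumes "finite F" "\<And>S. S \<in> F \<Longrightarrow> subspace S" "\<Union>F = UNIV"
  shows "UNIV \<in> F"
proof (rule ccontr)
  assume "UNIV \<notin> F"
  have "negligible S" if "S \<in> F" for S
  proof (rule negligible_lowdim)
    have "dim S \<noteq> DIM('a)"
      using that \<open>UNIV \<notin> F\<close> assms(2) by (metis dim_eq_full span_eq_iff)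
    then show "dim S < DIM('a)" using dim_subset_UNIV[of S] by simp
  qed
  then have "negligible (\<Union>F)" using assms(1) by blast
  then show False using assms(3) non_negligible_UNIV by simp
qed

lemma uniform_rearrangement:
  fixes \<psi> :: "real ^ 'n \<Rightarrow> real ^ 'n"
  assumes "linear \<psi>"
    and rearr: "\<And>x. \<exists>p. p permutes UNIV \<and> \<psi> (permute_entries s x) = permute_entries p (\<psi> x)"
  shows "\<exists>p. p permutes UNIV \<and> (\<forall>x. \<psi> (permute_entries s x) = permute_entries p (\<psi> x))"
proof -
  define E where "E p = {x. \<psi> (permute_entries s x) = permute_entries p (\<psi> x)}" for p
  have "UNIV \<in> E ` {p. p permutes UNIV}"
  proof (rule finite_Union_subspaces_UNIV)
    show "finite (E ` {p. p permutes UNIV})" by simp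
    show "\<Union> (E ` {p. p permutes UNIV}) = UNIV" using rearr by (auto simp: E_def)
    fix S assume "S \<in> E ` {p. p permutes UNIV}"
    then show "subspace S"
      by (auto simp: E_def subspace_def linear_0[OF assms(1)] linear_add[OF assms(1)]
          linear_cmul[OF assms(1)] linear_0[OF linear_permute_entries]
          linear_add[OF linear_permute_entries] linear_cmul[OF linear_permute_entries])
  qed
  then show ?thesis by (auto simp: E_def)
qed

lemma preserves_majorization_imp_rearrangement:
  fixes \<phi> :: "real ^ 'n \<Rightarrow> real ^ 'n"
  assumes pres: "preserves_majorization_on S \<phi>"
    and s: "s permutes UNIV" and x: "x \<in> S" "permute_entries s x \<in> S"
  shows "\<exists>p. p permutes UNIV \<and> \<phi> (permute_entries s x) = permute_entries p (\<phi> x)"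
proof -
  have "permute_entries s x \<preceq> x" "x \<preceq> permute_entries s x"
    using s by (auto intro!: majorized_of_decr_eq simp: decr_permute_entries)
  then have "decr (\<phi> (permute_entries s x)) = decr (\<phi> x)"
    using pres x by (intro majorized_antisym_decr) (auto simp: preserves_majorization_on_def)
  then show ?thesis by (rule decr_eq_imp_permute_entries)
qed

text \<open>The image of a coordinate vector is a column. Evaluating the uniform rearrangement at coordinate
  vectors turns it into a statement on the entries of the matrix.\<close>

lemma matrix_of_rearranging_map:
  fixes \<psi> :: "real ^ 'n \<Rightarrow> real ^ 'n"
  assumes "linear \<psi>"
    and rearr: "\<And>s x. s permutes UNIV \<Longrightarrow>
      \<exists>p. p permutes UNIV \<and> \<psi> (permute_entries s x) = permute_entries p (\<psi> x)"
  shows "(\<forall>k i j. \<psi> (axis i 1) $ k = \<psi> (axis j 1) $ k) \<or>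
    (\<exists>p c d. p permutes UNIV \<and> (\<forall>k j. \<psi> (axis j 1) $ k = (if j = p k then d else c)))"
proof (rule rows_closed_under_permutation[where M = "\<lambda>k j. \<psi> (axis j 1) $ k"])
  fix s :: "'n \<Rightarrow> 'n" and k assume s: "s permutes UNIV"
  obtain p where p: "p permutes UNIV" "\<And>x. \<psi> (permute_entries s x) = permute_entries p (\<psi> x)"
    using uniform_rearrangement[OF assms(1), of s] rearr[OF s] by blast
  have "\<psi> (axis j 1) $ inv p k = \<psi> (axis (s j) 1) $ k" for j
  proof -
    have "axis j 1 = (permute_entries s (axis (s j) 1) :: real ^ 'n)"
      by (simp add: vec_eq_iff axis_def inj_eq[OF permutes_inj[OF s]])
    then have "\<psi> (axis j 1) $ inv p k = permute_entries p (\<psi> (axis (s j) 1)) $ inv p k"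
      by (simp only: p(2))
    then show ?thesis by (simp add: permutes_inverses(1)[OF p(1)])
  qed
  then have "(\<lambda>j. \<psi> (axis j 1) $ k) \<circ> s = (\<lambda>j. \<psi> (axis j 1) $ inv p k)"
    by (simp add: comp_def)
  then show "(\<lambda>j. \<psi> (axis j 1) $ k) \<circ> s \<in> range (\<lambda>k j. \<psi> (axis j 1) $ k)"
    by blast
qed

section \<open>The characterization\<close>

lemma outer_product_nth: "outer_product v w $ i $ j = v $ i * w $ j"
  by (simp add: outer_product_def matrix_matrix_mult_def columnvector_def rowvector_def)

lemma inner_one_eq_sum: "1 \<bullet> (x :: real ^ 'n) = (\<Sum>i\<in>UNIV. x $ i)"
  by (simp add: inner_vec_def)

lemma inner_one_permute_entries:
  "s permutes UNIV \<Longrightarrow> 1 \<bullet> permute_entries s x = 1 \<bullet> x"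
  unfolding inner_one_eq_sum by (simp add: sum.permute[of s UNIV "\<lambda>i. x $ i"] comp_def)

text \<open>The projection that subtracts the mean from every entry lands in the zero-sum vectors, commutes with
  rearrangements and sends a coordinate vector to itself minus \<open>e / n\<close>. So passing from \<open>\<phi>\<close> to \<open>\<psi>\<close> subtracts \<open>\<phi> e / n\<close> from each
  column, a change that the term \<open>v e\<^sup>t\<close> makes up for.\<close>

lemma preserves_majorization_imp_matrix:
  fixes \<phi> :: "real ^ 'n \<Rightarrow> real ^ 'n"
  assumes "linear \<phi>" and pres: "preserves_majorization_on zero_sum \<phi>"
  shows "\<exists>(v :: real ^ 'n) (l :: real) (P :: real ^ 'n ^ 'n).
    P \<in> permutation_matrices \<and> matrix \<phi> = outer_product v 1 + l *\<^sub>R P"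
proof -
  define pr :: "real ^ 'n \<Rightarrow> real ^ 'n" where "pr x = x - ((1 \<bullet> x) / CARD('n)) *\<^sub>R 1" for x
  define \<psi> where "\<psi> = \<phi> \<circ> pr"
  define u where "u = (1 / CARD('n)) *\<^sub>R \<phi> 1"
  have "linear pr"
    by (rule linearI) (simp_all add: pr_def inner_add_right add_divide_distrib algebra_simps)
  then have "linear \<psi>" unfolding \<psi>_def using assms(1) by (rule linear_compose)
  have pr_zero_sum: "pr x \<in> zero_sum" for x
    by (simp add: zero_sum_def pr_def inner_diff_right inner_one_eq_sum[of 1])
  have pr_permute: "pr (permute_entries s x) = permute_entries s (pr x)" if "s permutes UNIV" for s x
    by (simp add: vec_eq_iff pr_def inner_one_permute_entries[OF that])
  have rearr: "\<exists>p. p permutes UNIV \<and> \<psi> (permute_entries s x) = permute_entries p (\<psi> x)"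
    if s: "s permutes UNIV" for s x
    using preserves_majorization_imp_rearrangement[OF pres s pr_zero_sum[of x]]
      pr_zero_sum[of "permute_entries s x"] by (simp add: \<psi>_def pr_permute[OF s])
  have shape: "(\<forall>k i j. \<psi> (axis i 1) $ k = \<psi> (axis j 1) $ k) \<or>
    (\<exists>p c d. p permutes UNIV \<and> (\<forall>k j. \<psi> (axis j 1) $ k = (if j = p k then d else c)))"
    by (rule matrix_of_rearranging_map) (fact \<open>linear \<psi>\<close>, rule rearr)
  have "\<psi> (axis j 1) = \<phi> (axis j 1) - u" for j
    using assms(1) by (simp add: \<psi>_def pr_def u_def linear_diff linear_cmul inner_axis)
  then have entry: "matrix \<phi> $ k $ j = \<psi> (axis j 1) $ k + u $ k" for k j
    by (simp add: matrix_def)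
  consider (const) "\<forall>k i j. \<psi> (axis i 1) $ k = \<psi> (axis j 1) $ k"
    | (perm) p c d where "p permutes UNIV" "\<And>k j. \<psi> (axis j 1) $ k = (if j = p k then d else c)"
    using shape by blast
  then show ?thesis
  proof cases
    case const
    \<comment> \<open>All columns of the matrix of \<open>\<psi>\<close> agree, so any of them can be chosen.\<close>
    define v where "v = (\<chi> k. \<psi> (axis undefined 1) $ k + u $ k)"
    have "matrix \<phi> = outer_product v 1 + 0 *\<^sub>R (\<chi> i j. if j = id i then 1 else 0)"
      using const by (simp add: vec_eq_iff outer_product_nth entry v_def)
    moreover have "(\<chi> i j. if j = id i then 1 else 0) \<in> (permutation_matrices :: (real ^ 'n ^ 'n) set)"
      unfolding permutation_matrices_def using permutes_id by blast
    ultimately show ?thesis by blast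
  next
    case perm
    define v where "v = (\<chi> k. c + u $ k)"
    have "matrix \<phi> = outer_product v 1 + (d - c) *\<^sub>R (\<chi> i j. if j = p i then 1 else 0)"
      by (simp add: vec_eq_iff outer_product_nth entry v_def perm(2))
    then show ?thesis using perm(1) unfolding permutation_matrices_def by blast
  qed
qed

lemma matrix_imp_preserves_majorization:
  fixes \<phi> :: "real ^ 'n \<Rightarrow> real ^ 'n"
  assumes "linear \<phi>" and P: "P \<in> permutation_matrices"
    and mat: "matrix \<phi> = outer_product v 1 + l *\<^sub>R P"
  shows "preserves_majorization_on zero_sum \<phi>"
proof -
  obtain p where p: "p permutes UNIV" "P = (\<chi> i j. if j = p i then 1 else 0)"
    using P by (auto simp: permutation_matrices_def)
  have \<phi>: "\<phi> x = l *\<^sub>R permute_entries p x" if "x \<in> zero_sum" for x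
  proof -
    have "((outer_product v 1 + l *\<^sub>R P) *v x) $ k = l * x $ p k" for k
    proof -
      have "((outer_product v 1 + l *\<^sub>R P) *v x) $ k
          = (\<Sum>j\<in>UNIV. v $ k * x $ j + l * (if j = p k then x $ j else 0))"
        unfolding matrix_vector_mult_def
        by (auto simp: outer_product_nth p(2) distrib_right intro!: sum.cong)
      also have "\<dots> = v $ k * (\<Sum>j\<in>UNIV. x $ j) + l * (\<Sum>j\<in>UNIV. if j = p k then x $ j else 0)"
        by (simp only: sum.distrib sum_distrib_left)
      also have "\<dots> = l * x $ p k"
        using that by (simp add: zero_sum_def inner_one_eq_sum)
      finally show ?thesis .
    qed
    then have "(outer_product v 1 + l *\<^sub>R P) *v x = l *\<^sub>R permute_entries p x"
      by (simp add: vec_eq_iff)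
    moreover have "\<phi> x = matrix \<phi> *v x"
      by (rule fun_cong[OF matrix_vector_mul(2)[OF assms(1)], symmetric])
    ultimately show ?thesis by (simp only: mat)
  qed
  have "permute_entries p a \<preceq> permute_entries p b" if "a \<preceq> b" for a b :: "real ^ 'n"
    using that by (simp add: majorized_def decr_permute_entries[OF p(1)])
  then show ?thesis
    by (simp add: preserves_majorization_on_def \<phi> majorized_scaleR)
qed

theorem theorem5p25:
  fixes \<phi> :: "real ^ 'n \<Rightarrow> real ^ 'n"
  assumes "linear \<phi>"
  shows "preserves_majorization_on zero_sum \<phi> \<longleftrightarrow>
    (\<exists>(v :: real ^ 'n) (l :: real) (P :: real ^ 'n ^ 'n).
       P \<in> permutation_matrices \<and> matrix \<phi> = outer_product v 1 + l *\<^sub>R P)"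
proof
  assume "preserves_majorization_on zero_sum \<phi>"
  then show "\<exists>v l P. P \<in> permutation_matrices \<and> matrix \<phi> = outer_product v 1 + l *\<^sub>R P"
    by (rule preserves_majorization_imp_matrix[OF assms])
next
  assume "\<exists>v l P. P \<in> permutation_matrices \<and> matrix \<phi> = outer_product v 1 + l *\<^sub>R P"
  then obtain v l P where "P \<in> permutation_matrices" "matrix \<phi> = outer_product v 1 + l *\<^sub>R P"
    by blast
  then show "preserves_majorization_on zero_sum \<phi>"
    by (rule matrix_imp_preserves_majorization[OF assms])
qed

end
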